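(* Let $\mathcal{D}=\{X\in\mathcal{S}^n:\ X=\operatorname{Diag}(\operatorname{diag}(X)),\ \operatorname{rank}(X)\le k,\ f(\operatorname{diag}(X))\le0\}$ and let $\tilde k\le k$ be its strengthened rank. Consider $$V_{\rm rel}:=\min_{X\in \operatorname{conv}(\mathcal{D})}\{\langle A_0,X\rangle:\ b_i^l\le\langle A_i,X\rangle\le b_i^u,\ \forall i\in[m]\}\qquad\text{(LSOP-R)},$$ and let $\tilde m$ be the number of linearly independent matrices among $A_1,\dots,A_m$. Suppose that $f$ is sign-invariant, i.e. $f(\lambda)=f(|\lambda|)$ for all $\lambda\in\mathbb{R}^n$, and that the feasible set of LSOP-R contains no line. Then: (i) every extreme point of the feasible set of LSOP-R has rank at most $\tilde k+\tilde m$; and (ii) there is an optimal solution to LSOP-R of rank at most $\tilde k+\tilde m$ if LSOP-R yields a finite optimal value, i.e., $V_{\rm rel}>-\infty$.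
   Context: $k\le n$ are positive integers; $[m]=\{1,\dots,m\}$; $\mathcal{S}^n$ is the space of $n\times n$ real symmetric matrices; $\operatorname{diag}(X)\in\mathbb{R}^n$ is the vector of diagonal entries of $X$, and $\operatorname{Diag}(x)$ is the diagonal matrix with diagonal $x$ (so $X=\operatorname{Diag}(\operatorname{diag}(X))$ says $X$ is diagonal). $\langle\cdot,\cdot\rangle$ is the Frobenius inner product; $\operatorname{conv}$ denotes convex hull; $|\lambda|$ is the entrywise absolute value. The function $f:\mathbb{R}^n\to\mathbb{R}$ is continuous, convex and symmetric (invariant under permutations of its arguments). $A_0,A_1,\dots,A_m\in\mathcal{S}^n$ and $-\infty\le b_i^l\le b_i^u\le+\infty$. The number $\tilde m$ is the dimension of the linear span of $\{A_i\}_{i\in[m]}$. Strengthened rank: $\tilde k$ with $1\le\tilde k\le k$ is the smallest integer such that $\operatorname{conv}(\mathcal{D})=\operatorname{conv}(\{X\in\mathcal{S}^n:\ X \text{ diagonal},\ \operatorname{rank}(X)\le\tilde k,\ f(\operatorname{diag}(X))\le0\})$. *)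

theory Defs
  imports "HOL-Analysis.Analysis"
begin

definition diag :: "real^'n^'n \<Rightarrow> real^'n"
  where "diag X = (\<chi> i. X $ i $ i)"

definition Diag :: "real^'n \<Rightarrow> real^'n^'n"
  where "Diag x = (\<chi> i j. if i = j then x $ i else 0)"

definition sym_matrices :: "(real^'n^'n) set"
  where "sym_matrices = {X. transpose X = X}"

definition symmetric_fun :: "(real^'n \<Rightarrow> real) \<Rightarrow> bool"
  where "symmetric_fun f \<longleftrightarrow> (\<forall>p x. p permutes UNIV \<longrightarrow> f (\<chi> i. x $ p i) = f x)"

definition sign_invariant :: "(real^'n \<Rightarrow> real) \<Rightarrow> bool"
  where "sign_invariant f \<longleftrightarrow> (\<forall>x. f x = f (\<chi> i. \<bar>x $ i\<bar>))"

definition domain_set :: "(real^'n \<Rightarrow> real) \<Rightarrow> nat \<Rightarrow> (real^'n^'n) set"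
  where "domain_set f k = {X \<in> sym_matrices. X = Diag (diag X) \<and> rank X \<le> k \<and> f (diag X) \<le> 0}"

(* For k \<ge> 1 the minimum exists, since k itself satisfies the condition. *)
definition strengthened_rank :: "(real^'n \<Rightarrow> real) \<Rightarrow> nat \<Rightarrow> nat"
  where "strengthened_rank f k =
    (LEAST k'. 1 \<le> k' \<and> k' \<le> k \<and> convex hull (domain_set f k) = convex hull (domain_set f k'))"

(* The inner product \<bullet> of the type real^'n^'n is the sum of the products of all
   entries, i.e. the Frobenius inner product. *)
definition lsop_feasible ::
  "(real^'n \<Rightarrow> real) \<Rightarrow> nat \<Rightarrow> (nat \<Rightarrow> real^'n^'n) \<Rightarrow> nat \<Rightarrow> (nat \<Rightarrow> ereal) \<Rightarrow> (nat \<Rightarrow> ereal)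
     \<Rightarrow> (real^'n^'n) set"
  where "lsop_feasible f k A m bl bu =
    {X \<in> convex hull (domain_set f k).
       \<forall>i\<in>{1..m}. bl i \<le> ereal (A i \<bullet> X) \<and> ereal (A i \<bullet> X) \<le> bu i}"

(* Extended-real valued, so that an infeasible problem has value \<infinity>
   and an unbounded one has value -\<infinity>. *)
definition lsop_value ::
  "(real^'n \<Rightarrow> real) \<Rightarrow> nat \<Rightarrow> (nat \<Rightarrow> real^'n^'n) \<Rightarrow> nat \<Rightarrow> (nat \<Rightarrow> ereal) \<Rightarrow> (nat \<Rightarrow> ereal)
     \<Rightarrow> ereal"
  where "lsop_value f k A m bl bu = (INF X\<in>lsop_feasible f k A m bl bu. ereal (A 0 \<bullet> X))"

definition lsop_optimal ::
  "(real^'n \<Rightarrow> real) \<Rightarrow> nat \<Rightarrow> (nat \<Rightarrow> real^'n^'n) \<Rightarrow> nat \<Rightarrow> (nat \<Rightarrow> ereal) \<Rightarrow> (nat \<Rightarrow> ereal)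
     \<Rightarrow> real^'n^'n \<Rightarrow> bool"
  where "lsop_optimal f k A m bl bu X \<longleftrightarrow>
    X \<in> lsop_feasible f k A m bl bu \<and> (\<forall>Y\<in>lsop_feasible f k A m bl bu. A 0 \<bullet> X \<le> A 0 \<bullet> Y)"

definition contains_line :: "'a::real_vector set \<Rightarrow> bool"
  where "contains_line S \<longleftrightarrow> (\<exists>x d. d \<noteq> 0 \<and> (\<forall>t. x + t *\<^sub>R d \<in> S))"

end

theory Submission
  imports Defs
begin

text \<open>
  Diagonal matrices are vectors, and the rank of a diagonal matrix is the number of nonzero
  entries. So the claim is about points $x$ of $C = \mathrm{conv}(D)$ in $\mathbb{R}^n$, where $D$
  consists of the vectors with at most $k$ nonzero entries on which $f \le 0$; the strengthened
  rank may take the place of $k$, as it gives the same $C$.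

  The heart of the matter is that a point of $C$ with $r$ nonzero entries lies in the relative
  interior of a face of dimension at least $r - k$ (lemma
  \<open>card_supp_le_dim_two_sided_directions\<close>). The bound for extreme points follows at once: at an
  extreme point of the feasible set, no nonzero direction of that face is orthogonal to all the
  constraint matrices, for otherwise one could move both ways without violating a constraint.
  Hence $r - k$ is at most the dimension of their span.

  The face is large because $D$ is invariant under signed transpositions of coordinates, which are
  reflections. Write $x$ as a convex combination of atoms $v \in D$ and, for a nonzero entry $p$
  of $x$, let $e_p$ be the unit vector with the sign of $x_p$. Reflecting an atom $v$ in the
  hyperplane orthogonal to $e_p - e_q$ moves $x$ along $e_p - e_q$, forwards or backwards
  according to the sign of $\langle e_p - e_q, v\rangle$. If both signs occur among the atoms, then
  $e_p - e_q$ belongs to the face. If not, then $p$ and $q$ are comparable: one of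
  $\langle e_p, v\rangle$ and $\langle e_q, v\rangle$ dominates the other for all atoms. Now pick as
  few coordinates as possible whose vectors $e_p$, together with the directions of the face, span
  all the $e_p$. They are pairwise comparable, hence form a chain, and an atom that is positive at
  the least of them is positive at all of them. An atom has at most $k$ nonzero entries, so at most
  $k$ coordinates were picked.

  For the existence of a low-rank optimal solution there are two cases. If $D$ is bounded, it is
  compact, and a linear function attains its minimum over the compact convex feasible set at an
  extreme point. If $D$ is unbounded, then the symmetries and convexity put all coordinate axes
  into $D$, so $C$ is the whole space and the problem is a linear program. A linear program with a
  finite value attains it, by a Farkas argument; and since the feasible polyhedron has no line, the
  constraint matrices span at least $n$ dimensions, so that the rank bound holds for every point.
\<close>

section \<open>Two-sided directions of a convex set\<close>

text \<open>
  For convex \<open>C\<close> and \<open>x \<in> C\<close> these directions form the linear space parallel to the affine hull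
  of the smallest face of \<open>C\<close> that contains \<open>x\<close>.
\<close>

definition two_sided_directions :: "'a::real_vector set \<Rightarrow> 'a \<Rightarrow> 'a set"
  where "two_sided_directions C x = {d. \<exists>t>0. x + t *\<^sub>R d \<in> C \<and> x - t *\<^sub>R d \<in> C}"

lemma step_shrink:
  fixes x :: "'a::real_vector"
  assumes "convex C" "x \<in> C" "x + t *\<^sub>R d \<in> C" "0 \<le> r" "r \<le> t"
  shows "x + r *\<^sub>R d \<in> C"
proof (cases "t = 0")
  case True
  with assms show ?thesis by simp
next
  case False
  with assms have "t > 0" by simp
  have "(1 - r / t) *\<^sub>R x + (r / t) *\<^sub>R (x + t *\<^sub>R d) \<in> C"
    using assms \<open>t > 0\<close> by (intro convexD) auto
  also have "(1 - r / t) *\<^sub>R x + (r / t) *\<^sub>R (x + t *\<^sub>R d) = x + r *\<^sub>R d"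
    using \<open>t > 0\<close> by (simp add: algebra_simps)
  finally show ?thesis .
qed

lemma two_sided_directionsI:
  fixes x :: "'a::real_vector"
  assumes "convex C" "x \<in> C" "0 < s" "x + s *\<^sub>R d \<in> C" "0 < t" "x - t *\<^sub>R d \<in> C"
  shows "d \<in> two_sided_directions C x"
proof -
  have "x + min s t *\<^sub>R d \<in> C"
    using step_shrink[of C x s d "min s t"] assms by simp
  moreover have "x + min s t *\<^sub>R (- d) \<in> C"
    using step_shrink[of C x t "- d" "min s t"] assms by simp
  ultimately show ?thesis
    using assms unfolding two_sided_directions_def
    by (intro CollectI exI[of _ "min s t"]) auto
qed

lemma subspace_two_sided_directions:
  fixes x :: "'a::real_vector"
  assumes "convex C" "x \<in> C"
  shows "subspace (two_sided_directions C x)"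
  unfolding subspace_def
proof (intro conjI ballI allI)
  show "0 \<in> two_sided_directions C x"
    using assms(2) by (auto simp: two_sided_directions_def intro: exI[of _ 1])
next
  fix c d
  assume "c \<in> two_sided_directions C x" "d \<in> two_sided_directions C x"
  then obtain s t where s: "s > 0" "x + s *\<^sub>R c \<in> C" "x - s *\<^sub>R c \<in> C"
    and t: "t > 0" "x + t *\<^sub>R d \<in> C" "x - t *\<^sub>R d \<in> C"
    by (auto simp: two_sided_directions_def)
  define r where "r = min s t"
  have "r > 0" using s t by (simp add: r_def)
  have c: "x + r *\<^sub>R c \<in> C" "x + r *\<^sub>R (- c) \<in> C"
    using step_shrink[OF assms, of s c r] step_shrink[OF assms, of s "- c" r] s \<open>r > 0\<close>
    by (auto simp: r_def)
  have d: "x + r *\<^sub>R d \<in> C" "x + r *\<^sub>R (- d) \<in> C"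
    using step_shrink[OF assms, of t d r] step_shrink[OF assms, of t "- d" r] t \<open>r > 0\<close>
    by (auto simp: r_def)
  have mid: "x + (r/2) *\<^sub>R (a + b) \<in> C" if "x + r *\<^sub>R a \<in> C" "x + r *\<^sub>R b \<in> C" for a b
  proof -
    have "(1/2) *\<^sub>R (x + r *\<^sub>R a) + (1/2) *\<^sub>R (x + r *\<^sub>R b) \<in> C"
      using that assms(1) by (intro convexD) auto
    also have "(1/2) *\<^sub>R (x + r *\<^sub>R a) + (1/2) *\<^sub>R (x + r *\<^sub>R b) = x + (r/2) *\<^sub>R (a + b)"
      by (simp add: algebra_simps flip: scaleR_left_distrib)
    finally show ?thesis .
  qed
  have "x + (r/2) *\<^sub>R (c + d) \<in> C" "x - (r/2) *\<^sub>R (c + d) \<in> C"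
    using mid[OF c(1) d(1)] mid[OF c(2) d(2)] by (auto simp: algebra_simps)
  with \<open>r > 0\<close> show "c + d \<in> two_sided_directions C x"
    unfolding two_sided_directions_def by (intro CollectI exI[of _ "r/2"]) auto
next
  fix a :: real and d
  assume "d \<in> two_sided_directions C x"
  then obtain t where t: "t > 0" "x + t *\<^sub>R d \<in> C" "x - t *\<^sub>R d \<in> C"
    by (auto simp: two_sided_directions_def)
  show "a *\<^sub>R d \<in> two_sided_directions C x"
  proof (cases a "0::real" rule: linorder_cases)
    case equal
    with assms(2) show ?thesis by (auto simp: two_sided_directions_def intro: exI[of _ 1])
  next
    case greater
    with t show ?thesis
      unfolding two_sided_directions_def by (intro CollectI exI[of _ "t/a"]) auto
  next
    case less
    with t show ?thesis
      unfolding two_sided_directions_def by (intro CollectI exI[of _ "t/(-a)"]) (auto simp: divide_pos_neg)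
  qed
qed

text \<open>
  A nonzero two-sided direction orthogonal to all \<open>a i\<close> would make \<open>x\<close> the midpoint of two other
  points that give the same values \<open>a i \<bullet> x\<close>. So the two-sided directions meet the orthogonal
  complement of the span only in 0, and counting dimensions gives the bound. The predicate \<open>P\<close> is
  arbitrary because these values do not change along such a direction.
\<close>

lemma dim_two_sided_directions_extreme_point:
  fixes C :: "'a::euclidean_space set" and a :: "'i \<Rightarrow> 'a"
  assumes "convex C" and ext: "x extreme_point_of {y \<in> C. \<forall>i\<in>I. P i (a i \<bullet> y)}"
  shows "dim (two_sided_directions C x) \<le> dim (span (a ` I))"
proof -
  let ?M = "two_sided_directions C x"
  let ?W = "span (a ` I)"
  let ?N = "{y \<in> UNIV. \<forall>z\<in>?W. orthogonal z y}"
  have x: "x \<in> C" "\<And>i. i \<in> I \<Longrightarrow> P i (a i \<bullet> x)"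
    using ext by (auto simp: extreme_point_of_def)
  have subM: "subspace ?M"
    using subspace_two_sided_directions assms(1) x(1) by blast
  have subN: "subspace ?N"
    by (auto simp: subspace_def orthogonal_def inner_add_right)
  have "?M \<inter> ?N \<subseteq> {0}"
  proof
    fix d assume d: "d \<in> ?M \<inter> ?N"
    then obtain t where t: "t > 0" "x + t *\<^sub>R d \<in> C" "x - t *\<^sub>R d \<in> C"
      by (auto simp: two_sided_directions_def)
    have "a i \<bullet> d = 0" if "i \<in> I" for i
      using d that by (auto simp: orthogonal_def intro: span_base)
    then have *: "x + t *\<^sub>R d \<in> {y \<in> C. \<forall>i\<in>I. P i (a i \<bullet> y)}"
      "x - t *\<^sub>R d \<in> {y \<in> C. \<forall>i\<in>I. P i (a i \<bullet> y)}"
      using t x(2) by (auto simp: inner_simps)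
    show "d \<in> {0}"
    proof (rule ccontr)
      assume "d \<notin> {0}"
      have eq: "x = (1 - 1/2) *\<^sub>R (x + t *\<^sub>R d) + (1/2) *\<^sub>R (x - t *\<^sub>R d)"
        by (simp add: algebra_simps flip: scaleR_left_distrib)
      have "x + t *\<^sub>R d \<noteq> x - t *\<^sub>R d"
      proof
        assume "x + t *\<^sub>R d = x - t *\<^sub>R d"
        then have "(2 * t) *\<^sub>R d = 0" by (simp add: algebra_simps scaleR_2 flip: scaleR_scaleR)
        with t \<open>d \<notin> {0}\<close> show False by simp
      qed
      then have "x \<in> open_segment (x + t *\<^sub>R d) (x - t *\<^sub>R d)"
        unfolding in_segment using eq by (intro conjI exI[of _ "1/2"]) auto
      with * ext show False unfolding extreme_point_of_def by blast
    qed
  qed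
  then have "dim (?M \<inter> ?N) = 0"
    by (simp only: dim_eq_0)
  moreover have "dim ?N + dim ?W = DIM('a)"
    using dim_subspace_orthogonal_to_vectors[of ?W UNIV] by simp
  moreover have "dim {u + v |u v. u \<in> ?M \<and> v \<in> ?N} + dim (?M \<inter> ?N) = dim ?M + dim ?N"
    by (rule dim_sums_Int[OF subM subN])
  moreover have "dim {u + v |u v. u \<in> ?M \<and> v \<in> ?N} \<le> DIM('a)"
    by (rule dim_subset_UNIV)
  ultimately show ?thesis by linarith
qed

section \<open>Supports of points in hulls of symmetric sets\<close>

definition supp :: "real^'n \<Rightarrow> 'n set"
  where "supp x = {i. x $ i \<noteq> 0}"

text \<open>
  The vectors \<open>axis p a - axis q b\<close> with \<open>\<bar>a\<bar> = \<bar>b\<bar> = 1\<close> have squared length 2, so the first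
  assumption says that \<open>D\<close> is closed under the reflections in their orthogonal hyperplanes, which
  are the signed transpositions of coordinates. Reflecting single atoms of a convex combination
  is what produces directions in which one can leave \<open>x\<close> within the hull.
\<close>

lemma card_supp_le_dim_two_sided_directions:
  fixes D :: "(real^'n) set"
  assumes reflection: "\<And>y p q a b. \<lbrakk>y \<in> D; p \<noteq> q; \<bar>a\<bar> = 1; \<bar>b\<bar> = 1\<rbrakk> \<Longrightarrow>
      y - ((axis p a - axis q b) \<bullet> y) *\<^sub>R (axis p a - axis q b) \<in> D"
    and sparse: "\<And>y. y \<in> D \<Longrightarrow> card (supp y) \<le> k"
    and x: "x \<in> convex hull D"
  shows "card (supp x) \<le> k + dim (two_sided_directions (convex hull D) x)"
proof -
  let ?C = "convex hull D"
  let ?M = "two_sided_directions ?C x"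
  obtain S w where S: "finite S" "S \<subseteq> D" and w: "\<And>v. v \<in> S \<Longrightarrow> 0 \<le> w v" "sum w S = 1"
    and sum: "(\<Sum>v\<in>S. w v *\<^sub>R v) = x"
    using x by (auto simp: convex_hull_explicit)
  define e :: "'n \<Rightarrow> real^'n" where "e p = axis p (sgn (x $ p))" for p
  have e_inner: "e p \<bullet> v = sgn (x $ p) * v $ p" for p v
    by (simp add: e_def inner_axis inner_commute)
  have x_inner: "(\<Sum>v\<in>S. w v * (e p \<bullet> v)) = \<bar>x $ p\<bar>" for p
  proof -
    have "(\<Sum>v\<in>S. w v * (e p \<bullet> v)) = e p \<bullet> x"
      by (simp add: inner_sum_right flip: sum)
    then show ?thesis by (simp add: e_inner abs_sgn mult.commute)
  qed
  have subM: "subspace ?M"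
    using x by (intro subspace_two_sided_directions) auto

  \<comment> \<open>Replacing the atom \<open>v\<close> by its reflection keeps the combination in the hull.\<close>
  have move: "x - (w v * (u \<bullet> v)) *\<^sub>R u \<in> ?C"
    if "v \<in> S" "u = e p - e q" "p \<in> supp x" "q \<in> supp x" "p \<noteq> q" for u v p q
  proof -
    let ?y = "\<lambda>z. if z = v then v - (u \<bullet> v) *\<^sub>R u else z"
    have "?y z \<in> ?C" if "z \<in> S" for z
      using reflection[of v p q "sgn (x $ p)" "sgn (x $ q)"] S that \<open>v \<in> S\<close> \<open>u = e p - e q\<close>
        \<open>p \<in> supp x\<close> \<open>q \<in> supp x\<close> \<open>p \<noteq> q\<close>
      by (auto simp: e_def supp_def abs_sgn_eq intro!: hull_inc)
    then have "(\<Sum>z\<in>S. w z *\<^sub>R ?y z) \<in> ?C"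
      using S w by (intro convex_sum) auto
    also have "(\<Sum>z\<in>S. w z *\<^sub>R ?y z) = (\<Sum>z\<in>S. w z *\<^sub>R z - (if z = v then (w v * (u \<bullet> v)) *\<^sub>R u else 0))"
      by (intro sum.cong) (auto simp: algebra_simps)
    also have "\<dots> = x - (w v * (u \<bullet> v)) *\<^sub>R u"
      using S(1) \<open>v \<in> S\<close> sum by (simp add: sum_subtractf sum.delta')
    finally show ?thesis .
  qed
  have edge: "e p - e q \<in> ?M"
    if "p \<in> supp x" "q \<in> supp x" "p \<noteq> q"
      "v \<in> S" "w v > 0" "(e p - e q) \<bullet> v > 0" "v' \<in> S" "w v' > 0" "(e p - e q) \<bullet> v' < 0"
    for p q v v'
  proof (rule two_sided_directionsI)
    show "x + (w v' * - ((e p - e q) \<bullet> v')) *\<^sub>R (e p - e q) \<in> ?C"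
      using move[OF \<open>v' \<in> S\<close> refl that(1-3)] by simp
    show "x - (w v * ((e p - e q) \<bullet> v)) *\<^sub>R (e p - e q) \<in> ?C"
      using move[OF \<open>v \<in> S\<close> refl that(1-3)] .
    show "0 < w v' * - ((e p - e q) \<bullet> v')" "0 < w v * ((e p - e q) \<bullet> v)"
      using that by (auto simp: mult_pos_neg)
  qed (use x in auto)

  \<comment> \<open>A smallest set of coordinates that generates all of them modulo the two-sided directions:
    minimality keeps any difference of two of its vectors \<open>e p\<close> out of these directions.\<close>
  define gen where "gen R \<longleftrightarrow> R \<subseteq> supp x \<and> e ` supp x \<subseteq> span (?M \<union> e ` R)" for R
  have "gen (supp x)"
    by (auto simp: gen_def intro: span_base)
  then obtain R where R: "gen R" and R_min: "\<And>R'. gen R' \<Longrightarrow> card R \<le> card R'"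
    using ex_has_least_nat[of gen _ card] by blast
  have no_edge: "e p - e q \<notin> ?M" if "p \<in> R" "q \<in> R" "p \<noteq> q" for p q
  proof
    assume M: "e p - e q \<in> ?M"
    let ?V = "span (?M \<union> e ` (R - {p}))"
    have "e q \<in> ?V" "e p - e q \<in> ?V"
      using that M by (auto intro: span_base)
    then have "e p \<in> ?V"
      using span_add by fastforce
    then have "?M \<union> e ` R \<subseteq> ?V"
      by (auto intro: span_base)
    then have "span (?M \<union> e ` R) \<subseteq> ?V"
      by (simp add: span_minimal)
    then have "gen (R - {p})"
      using R by (auto simp: gen_def)
    from R_min[OF this] that show False
      by (metis card_Diff1_less finite not_le)
  qed

  have "card R \<le> k"
  proof (cases "R = {}")
    case False
    \<comment> \<open>The members of \<open>R\<close> are pairwise comparable with respect to their values on the atoms. As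
      \<open>\<bar>x $ p\<bar>\<close> is the weighted mean of these values, the least member minimises \<open>\<bar>x $ p\<bar>\<close>.\<close>
    then obtain p where p: "p \<in> R" and p_min: "\<And>q. q \<in> R \<Longrightarrow> \<bar>x $ p\<bar> \<le> \<bar>x $ q\<bar>"
      using arg_min_if_finite(1)[of R "\<lambda>p. \<bar>x $ p\<bar>"] arg_min_least[of R _ "\<lambda>p. \<bar>x $ p\<bar>"] by auto
    have "p \<in> supp x" using p R by (auto simp: gen_def)
    then have "\<not> (\<Sum>v\<in>S. w v * (e p \<bullet> v)) \<le> 0"
      by (simp add: x_inner supp_def)
    then obtain v where v: "v \<in> S" "w v * (e p \<bullet> v) > 0"
      by (meson not_le sum_nonpos)
    with w have vp: "w v > 0" "e p \<bullet> v > 0"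
      by (auto simp: zero_less_mult_iff dest!: w(1))
    have "e q \<bullet> v > 0" if "q \<in> R" for q
    proof (cases "q = p")
      case False
      have q: "q \<in> supp x" using that R by (auto simp: gen_def)
      consider "\<And>v'. v' \<in> S \<Longrightarrow> w v' > 0 \<Longrightarrow> (e p - e q) \<bullet> v' \<le> 0"
        | "\<And>v'. v' \<in> S \<Longrightarrow> w v' > 0 \<Longrightarrow> (e p - e q) \<bullet> v' \<ge> 0"
        using edge[OF \<open>p \<in> supp x\<close> q] no_edge[OF p \<open>q \<in> R\<close>] False by (metis not_le)
      then show ?thesis
      proof cases
        case 1
        from 1[OF v(1) vp(1)] vp(2) show ?thesis by (simp add: inner_diff_left)
      next
        case 2
        \<comment> \<open>Here \<open>q\<close> lies below \<open>p\<close>, so by the choice of \<open>p\<close> they agree on every atom of positive weight.\<close>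
        have nonneg: "0 \<le> w v' * ((e p - e q) \<bullet> v')" if "v' \<in> S" for v'
          using 2[OF that] w(1)[OF that] by (cases "w v' = 0") auto
        have "(\<Sum>v'\<in>S. w v' * ((e p - e q) \<bullet> v')) = \<bar>x $ p\<bar> - \<bar>x $ q\<bar>"
          by (simp add: inner_diff_left right_diff_distrib sum_subtractf x_inner)
        with p_min[OF that] sum_nonneg[of S "\<lambda>v'. w v' * ((e p - e q) \<bullet> v')"] nonneg
        have "(\<Sum>v'\<in>S. w v' * ((e p - e q) \<bullet> v')) = 0" by force
        then have "w v * ((e p - e q) \<bullet> v) = 0"
          using sum_nonneg_eq_0_iff[OF S(1), of "\<lambda>v'. w v' * ((e p - e q) \<bullet> v')"] nonneg v(1) by blast
        with vp show ?thesis by (simp add: inner_diff_left)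
      qed
    qed (use vp in simp)
    then have "R \<subseteq> supp v"
      by (force simp: supp_def e_inner)
    then have "card R \<le> card (supp v)" by (simp add: card_mono)
    with sparse S v(1) show ?thesis by force
  qed simp

  moreover have "card (supp x) \<le> dim ?M + card R"
  proof -
    obtain B where B: "B \<subseteq> ?M" "independent B" "?M \<subseteq> span B" "card B = dim ?M"
      using basis_exists by blast
    have "finite B" using B(2) by (rule independent_imp_finite)
    have ne: "p = q" if "p \<in> supp x" "e p \<bullet> e q \<noteq> 0" for p q
      using that unfolding e_inner by (auto simp: e_def axis_def split: if_splits)
    have nz: "e p \<bullet> e p \<noteq> 0" if "p \<in> supp x" for p
      using that by (simp add: e_inner e_def supp_def sgn_zero_iff)
    have inj: "inj_on e (supp x)"
      by (rule inj_onI) (metis ne nz)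
    have "independent (e ` supp x)"
    proof (rule pairwise_orthogonal_independent)
      show "pairwise orthogonal (e ` supp x)"
        by (auto simp: pairwise_def orthogonal_def dest: ne)
      show "0 \<notin> e ` supp x" using nz by force
    qed
    then have "card (supp x) = dim (e ` supp x)"
      using inj by (simp add: dim_eq_card_independent card_image)
    also have "\<dots> \<le> card (B \<union> e ` R)"
    proof (rule dim_le_card)
      have "?M \<union> e ` R \<subseteq> span (B \<union> e ` R)"
        using B(3) span_mono[of B "B \<union> e ` R"] by (auto intro: span_base)
      then have "span (?M \<union> e ` R) \<subseteq> span (B \<union> e ` R)"
        by (simp add: span_minimal)
      then show "e ` supp x \<subseteq> span (B \<union> e ` R)"
        using R by (auto simp: gen_def)
    qed (use \<open>finite B\<close> in simp)
    also have "\<dots> \<le> card B + card (e ` R)" by (rule card_Un_le)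
    also have "\<dots> \<le> dim ?M + card R"
      using B(4) card_image_le[of R e] by simp
    finally show ?thesis .
  qed
  ultimately show ?thesis by linarith
qed

section \<open>Linear programs attain finite values\<close>

text \<open>
  Attaining the infimum \<open>v\<close> means solving the inequalities of \<open>P\<close> together with \<open>c \<bullet> x \<le> v\<close>.
  Homogenise: a solution is a hyperplane that separates \<open>(0, -1)\<close> from the cone generated by the
  pairs of coefficients and right-hand sides and by \<open>(0, 1)\<close>. This cone is finitely generated,
  hence closed, so it suffices that it does not contain \<open>(0, -1)\<close>. If it did, \<open>c \<bullet> x\<close> would stay
  above \<open>v\<close> by a fixed amount on all of \<open>P\<close>.
\<close>

lemma linear_program_attains:
  fixes P :: "'a::euclidean_space set" and c :: 'a
  assumes "polyhedron P" "P \<noteq> {}" and bdd: "\<And>x. x \<in> P \<Longrightarrow> l \<le> c \<bullet> x"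
  obtains x where "x \<in> P" "\<And>y. y \<in> P \<Longrightarrow> c \<bullet> x \<le> c \<bullet> y"
proof -
  obtain F where F: "finite F" "P = \<Inter>F" and "\<forall>h\<in>F. \<exists>a b. a \<noteq> 0 \<and> h = {x. a \<bullet> x \<le> b}"
    using assms(1) unfolding polyhedron_def by (elim exE conjE)
  then obtain a b where ab: "\<And>h. h \<in> F \<Longrightarrow> h = {x. a h \<bullet> x \<le> (b h :: real)}"
    by metis
  have P: "x \<in> P \<longleftrightarrow> (\<forall>h\<in>F. a h \<bullet> x \<le> b h)" for x
    using ab F(2) by auto
  define v where "v = Inf ((\<bullet>) c ` P)"
  have bb: "bdd_below ((\<bullet>) c ` P)"
    using bdd by (auto simp: bdd_below_def)
  have v_le: "v \<le> c \<bullet> x" if "x \<in> P" for x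
    unfolding v_def using bb that by (auto intro: cInf_lower)
  define G where "G = (\<lambda>h. (a h, b h)) ` F \<union> {(c, v), (0, 1)}"
  let ?K = "convex_cone hull G"
  \<comment> \<open>A convex cone around \<open>?K\<close> that records what the members of \<open>?K\<close> imply on \<open>P\<close>: the number
    \<open>\<mu>\<close> is the coefficient of the generator \<open>(c, v)\<close>.\<close>
  define T where "T = {z :: 'a \<times> real. \<exists>\<mu>\<ge>0. \<forall>x\<in>P. fst z \<bullet> x \<le> snd z + \<mu> * (c \<bullet> x - v)}"
  have "G \<subseteq> T"
  proof
    fix z assume "z \<in> G"
    then consider h where "h \<in> F" "z = (a h, b h)" | "z = (c, v)" | "z = (0, 1)"
      by (auto simp: G_def)
    then show "z \<in> T"
    proof cases
      case 1
      then show ?thesis using P by (auto simp: T_def intro: exI[of _ 0])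
    next
      case 2
      then show ?thesis by (auto simp: T_def intro: exI[of _ 1])
    next
      case 3
      then show ?thesis by (auto simp: T_def intro: exI[of _ 0])
    qed
  qed
  moreover have "convex_cone T"
    unfolding convex_cone_iff
  proof (intro conjI ballI allI impI)
    show "0 \<in> T" by (auto simp: T_def intro: exI[of _ 0])
  next
    fix y z assume "y \<in> T" "z \<in> T"
    then obtain \<mu> \<nu> where "\<mu> \<ge> 0" "\<forall>x\<in>P. fst y \<bullet> x \<le> snd y + \<mu> * (c \<bullet> x - v)"
      "\<nu> \<ge> 0" "\<forall>x\<in>P. fst z \<bullet> x \<le> snd z + \<nu> * (c \<bullet> x - v)"
      by (auto simp: T_def)
    then show "y + z \<in> T"
      unfolding T_def by (intro CollectI exI[of _ "\<mu> + \<nu>"]) (force simp: inner_add_left distrib_right)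
  next
    fix z and r :: real assume "z \<in> T" "0 \<le> r"
    then obtain \<mu> where \<mu>: "\<mu> \<ge> 0" "\<forall>x\<in>P. fst z \<bullet> x \<le> snd z + \<mu> * (c \<bullet> x - v)"
      by (auto simp: T_def)
    have "r * (fst z \<bullet> x) \<le> r * snd z + r * \<mu> * (c \<bullet> x - v)" if "x \<in> P" for x
      using mult_left_mono[OF \<mu>(2)[rule_format, OF that] \<open>0 \<le> r\<close>] by (simp add: algebra_simps)
    with \<mu>(1) \<open>0 \<le> r\<close> show "r *\<^sub>R z \<in> T"
      unfolding T_def by (intro CollectI exI[of _ "r * \<mu>"]) auto
  qed
  ultimately have "?K \<subseteq> T" by (rule hull_minimal)
  moreover have "(0, -1) \<notin> T"
  proof
    assume "(0, -1) \<in> T"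
    then obtain \<mu> where \<mu>: "\<mu> \<ge> 0" "\<And>x. x \<in> P \<Longrightarrow> 1 \<le> \<mu> * (c \<bullet> x - v)"
      by (auto simp: T_def)
    with assms(2) have "\<mu> > 0"
      by (metis all_not_in_conv le_less mult_zero_left not_one_le_zero)
    have "v + 1 / \<mu> \<le> Inf ((\<bullet>) c ` P)"
    proof (rule cInf_greatest)
      show "(\<bullet>) c ` P \<noteq> {}" using assms(2) by simp
      fix y assume "y \<in> (\<bullet>) c ` P"
      then obtain x where x: "x \<in> P" "y = c \<bullet> x" by auto
      from \<mu>(2)[OF x(1)] \<open>\<mu> > 0\<close> have "1 / \<mu> \<le> c \<bullet> x - v"
        by (simp add: field_simps)
      then show "v + 1 / \<mu> \<le> y"
        using x(2) by simp
    qed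
    with \<open>\<mu> > 0\<close> show False by (simp add: v_def)
  qed
  ultimately have "(0, -1) \<notin> ?K" by blast
  moreover have "closed ?K"
    using F(1) by (intro polyhedron_imp_closed polyhedron_convex_cone_hull) (simp add: G_def)
  ultimately obtain z \<beta> where z: "z \<bullet> (0, -1) < \<beta>" "\<And>y. y \<in> ?K \<Longrightarrow> \<beta> < z \<bullet> y"
    using separating_hyperplane_closed_point[OF convex_convex_cone_hull] by blast
  have K_nonneg: "0 \<le> z \<bullet> y" if "y \<in> ?K" for y
  proof (rule ccontr)
    assume neg: "\<not> 0 \<le> z \<bullet> y"
    have "\<beta> < 0" using z(2)[OF convex_cone_hull_contains_0] by simp
    have "(\<beta> / (z \<bullet> y)) *\<^sub>R y \<in> ?K"
      using neg \<open>\<beta> < 0\<close> that by (intro convex_cone_scaleR convex_cone_convex_cone_hull) (auto simp: divide_nonpos_neg)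
    from z(2)[OF this] neg show False by simp
  qed
  obtain p r where pr: "z = (p, r)" by fastforce
  have "r > 0"
    using z(1) z(2)[OF convex_cone_hull_contains_0] pr by simp
  have feasible: "a' \<bullet> ((- 1 / r) *\<^sub>R p) \<le> b'" if "(a', b') \<in> G" for a' b'
  proof -
    have "0 \<le> p \<bullet> a' + r * b'"
      using K_nonneg[OF hull_inc[OF that]] pr by simp
    with \<open>r > 0\<close> show ?thesis by (simp add: field_simps inner_commute)
  qed
  show ?thesis
  proof (rule that[of "(- 1 / r) *\<^sub>R p"])
    show "(- 1 / r) *\<^sub>R p \<in> P"
      unfolding P using feasible by (simp add: G_def)
    show "c \<bullet> ((- 1 / r) *\<^sub>R p) \<le> c \<bullet> y" if "y \<in> P" for y
      using feasible[of c v] v_le[OF that] by (simp add: G_def)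
  qed
qed

section \<open>Diagonal matrices as vectors\<close>

lemma linear_Diag: "linear Diag"
  by (rule linearI) (auto simp: Diag_def vec_eq_iff)

lemma diag_Diag [simp]: "diag (Diag x) = x"
  by (simp add: diag_def Diag_def vec_eq_iff)

lemma inj_Diag: "inj Diag"
  by (metis diag_Diag injI)

lemma linear_diag: "linear diag"
  by (rule linearI) (auto simp: diag_def vec_eq_iff)

lemma Diag_sym: "Diag x \<in> sym_matrices"
  by (auto simp: sym_matrices_def transpose_def Diag_def vec_eq_iff)

lemma inner_Diag: "A \<bullet> Diag x = diag A \<bullet> x"
  by (simp add: inner_vec_def Diag_def diag_def if_distrib[of "\<lambda>y. _ * y"] cong: if_cong)

lemma rank_Diag:
  fixes x :: "real^'n"
  shows "rank (Diag x) = card (supp x)"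
proof -
  have mult: "Diag x *v y = (\<chi> i. x $ i * y $ i)" for y :: "real^'n"
    by (simp add: matrix_vector_mult_def Diag_def vec_eq_iff if_distrib[of "\<lambda>z. z * _"] cong: if_cong)
  have "range ((*v) (Diag x)) = {y. \<forall>i. i \<notin> supp x \<longrightarrow> y $ i = 0}"
  proof (intro subset_antisym subsetI)
    fix y :: "real^'n" assume "y \<in> {y. \<forall>i. i \<notin> supp x \<longrightarrow> y $ i = 0}"
    then have "y = Diag x *v (\<chi> i. y $ i / x $ i)"
      by (auto simp: mult vec_eq_iff supp_def)
    then show "y \<in> range ((*v) (Diag x))" by blast
  qed (auto simp: mult supp_def)
  then show ?thesis
    by (simp add: rank_dim_range dim_substandard_cart flip: dim_vec_eq)
qed

definition sparse_sublevel :: "(real^'n \<Rightarrow> real) \<Rightarrow> nat \<Rightarrow> (real^'n) set"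
  where "sparse_sublevel f k = {x. card (supp x) \<le> k \<and> f x \<le> 0}"

lemma domain_set_eq: "domain_set f k = Diag ` sparse_sublevel f k"
proof (intro subset_antisym subsetI)
  fix X assume "X \<in> domain_set f k"
  then have "X = Diag (diag X)" "rank X \<le> k" "f (diag X) \<le> 0"
    by (auto simp: domain_set_def)
  moreover from this have "card (supp (diag X)) \<le> k"
    by (metis rank_Diag)
  ultimately show "X \<in> Diag ` sparse_sublevel f k"
    unfolding sparse_sublevel_def by blast
qed (auto simp: domain_set_def sparse_sublevel_def rank_Diag Diag_sym)

lemma convex_hull_domain_set:
  "convex hull (domain_set f k) = Diag ` (convex hull (sparse_sublevel f k))"
  by (simp add: domain_set_eq convex_hull_linear_image linear_Diag)

definition feasible_diagonals ::
  "(real^'n) set \<Rightarrow> (nat \<Rightarrow> real^'n^'n) \<Rightarrow> nat \<Rightarrow> (nat \<Rightarrow> ereal) \<Rightarrow> (nat \<Rightarrow> ereal) \<Rightarrow> (real^'n) set"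
  where "feasible_diagonals C A m bl bu =
    {x \<in> C. \<forall>i\<in>{1..m}. bl i \<le> ereal (diag (A i) \<bullet> x) \<and> ereal (diag (A i) \<bullet> x) \<le> bu i}"

lemma lsop_feasible_eq:
  "lsop_feasible f k A m bl bu =
    Diag ` feasible_diagonals (convex hull (sparse_sublevel f k)) A m bl bu"
  by (auto simp: lsop_feasible_def feasible_diagonals_def convex_hull_domain_set inner_Diag)

lemma polyhedron_ereal_bounds:
  fixes a :: "'a::euclidean_space"
  shows "polyhedron {x. l \<le> ereal (a \<bullet> x) \<and> ereal (a \<bullet> x) \<le> u}"
proof -
  have "polyhedron {x. l \<le> ereal (a \<bullet> x)}"
    by (cases l) (simp_all add: polyhedron_halfspace_ge)
  moreover have "polyhedron {x. ereal (a \<bullet> x) \<le> u}"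
    by (cases u) (simp_all add: polyhedron_halfspace_le)
  ultimately have "polyhedron ({x. l \<le> ereal (a \<bullet> x)} \<inter> {x. ereal (a \<bullet> x) \<le> u})"
    by (rule polyhedron_Int)
  then show ?thesis by (simp add: Int_def)
qed

lemma polyhedron_feasible_diagonals: "polyhedron (feasible_diagonals UNIV A m bl bu)"
proof -
  let ?H = "\<lambda>i. {x. bl i \<le> ereal (diag (A i) \<bullet> x) \<and> ereal (diag (A i) \<bullet> x) \<le> bu i}"
  have "polyhedron (\<Inter>(?H ` {1..m}))"
    by (rule polyhedron_Inter) (auto intro: polyhedron_ereal_bounds)
  moreover have "\<Inter>(?H ` {1..m}) = feasible_diagonals UNIV A m bl bu"
    by (auto simp: feasible_diagonals_def)
  ultimately show ?thesis by simp
qed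

lemma feasible_diagonals_Int:
  "feasible_diagonals C A m bl bu = C \<inter> feasible_diagonals UNIV A m bl bu"
  by (auto simp: feasible_diagonals_def)

lemma dim_diag_image_le: "dim (span (diag ` B)) \<le> dim (span B)"
  using dim_image_le[OF linear_diag, of B] by simp

section \<open>Symmetric sign-invariant functions\<close>

text \<open>
  A signed transposition permutes the absolute values of the entries by a transposition, and both
  \<open>f\<close> and the size of the support depend only on these absolute values up to order.
\<close>

lemma sparse_sublevel_reflection:
  fixes f :: "real^'n \<Rightarrow> real"
  assumes "symmetric_fun f" "sign_invariant f"
    and y: "y \<in> sparse_sublevel f k" and "p \<noteq> q" "\<bar>a\<bar> = 1" "\<bar>b\<bar> = 1"
  shows "y - ((axis p a - axis q b) \<bullet> y) *\<^sub>R (axis p a - axis q b) \<in> sparse_sublevel f k"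
    (is "?z \<in> _")
proof -
  define \<pi> where "\<pi> = Transposition.transpose p q"
  have \<pi>: "\<pi> permutes UNIV" "bij \<pi>"
    by (simp_all add: \<pi>_def permutes_swap_id bij_swap_iff)
  have inner: "(axis p a - axis q b) \<bullet> y = a * y $ p - b * y $ q"
    by (simp add: inner_diff_left inner_axis')
  have ab: "a * a = 1" "b * b = 1"
    using assms(5,6) by (auto simp: abs_eq_iff' abs_if split: if_splits)
  have abs_z: "\<bar>?z $ i\<bar> = \<bar>y $ \<pi> i\<bar>" for i
  proof -
    consider "i = p" | "i = q" | "i \<noteq> p" "i \<noteq> q" by blast
    then show ?thesis
    proof cases
      case 1
      have "?z $ p = y $ p - (a * a) * y $ p + a * b * y $ q"
        using \<open>p \<noteq> q\<close> by (simp only: inner) (simp add: axis_def algebra_simps)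
      with 1 assms(5,6) ab show ?thesis by (simp add: \<pi>_def abs_mult)
    next
      case 2
      have "?z $ q = y $ q - (b * b) * y $ q + a * b * y $ p"
        using \<open>p \<noteq> q\<close> by (simp only: inner) (simp add: axis_def algebra_simps)
      with 2 assms(5,6) ab show ?thesis by (simp add: \<pi>_def abs_mult)
    next
      case 3
      then show ?thesis by (simp add: axis_def \<pi>_def)
    qed
  qed
  have "f ?z = f (\<chi> i. \<bar>?z $ i\<bar>)"
    using assms(2) unfolding sign_invariant_def by blast
  also have "\<dots> = f (\<chi> i. (\<chi> j. \<bar>y $ j\<bar>) $ \<pi> i)"
    by (simp only: abs_z vec_lambda_beta)
  also have "\<dots> = f (\<chi> j. \<bar>y $ j\<bar>)"
    using assms(1) \<pi>(1) unfolding symmetric_fun_def by blast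
  also have "\<dots> = f y"
    using assms(2) unfolding sign_invariant_def by metis
  finally have "f ?z = f y" .
  moreover have "supp ?z = \<pi> -` supp y"
    using abs_z by (auto simp: supp_def simp del: vector_minus_component vector_scaleR_component)
      (metis abs_eq_0)+
  then have "card (supp ?z) = card (supp y)"
    using \<pi>(2) by (simp add: card_vimage_inj bij_is_inj bij_is_surj)
  ultimately show ?thesis
    using y by (simp add: sparse_sublevel_def)
qed

text \<open>
  Flipping the signs of all entries of \<open>x\<close> except the one at \<open>i\<close> does not change \<open>f\<close>, and the mean
  of \<open>x\<close> and its flip is \<open>axis i (x $ i)\<close>. Hence the sublevel set contains the segment between
  this vector and its negative, and by symmetry the corresponding segment on every other axis.
\<close>

lemma axis_sublevel:
  fixes f :: "real^'n \<Rightarrow> real"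
  assumes "convex_on UNIV f" "symmetric_fun f" "sign_invariant f"
    and "f x \<le> 0" "\<bar>t\<bar> \<le> \<bar>x $ i\<bar>"
  shows "f (axis j t) \<le> 0"
proof -
  have comb: "f ((1 - s) *\<^sub>R u + s *\<^sub>R v) \<le> 0"
    if "f u \<le> 0" "f v \<le> 0" "0 \<le> s" "s \<le> 1" for u v s
  proof -
    have "f ((1 - s) *\<^sub>R u + s *\<^sub>R v) \<le> (1 - s) * f u + s * f v"
      using convex_onD[OF assms(1)] that by simp
    also have "\<dots> \<le> 0"
      using that by (intro add_nonpos_nonpos mult_nonneg_nonpos) auto
    finally show ?thesis .
  qed
  have abs: "f u = f v" if "\<And>i. \<bar>u $ i\<bar> = \<bar>v $ i\<bar>" for u v
  proof -
    have "f u = f (\<chi> i. \<bar>u $ i\<bar>)" "f v = f (\<chi> i. \<bar>v $ i\<bar>)"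
      using assms(3) unfolding sign_invariant_def by blast+
    with that show ?thesis by simp
  qed
  define y where "y = axis i (x $ i)"
  have "f (2 *\<^sub>R y - x) = f x"
    by (rule abs) (simp add: y_def axis_def)
  then have "f ((1 - 1/2) *\<^sub>R x + (1/2) *\<^sub>R (2 *\<^sub>R y - x)) \<le> 0"
    using assms(4) by (intro comb) auto
  moreover have "(1 - 1/2) *\<^sub>R x + (1/2) *\<^sub>R (2 *\<^sub>R y - x) = y"
    by (simp add: vec_eq_iff field_simps)
  ultimately have y: "f y \<le> 0" by simp
  have "f (- y) = f y" by (rule abs) simp
  with y have "f (- y) \<le> 0" by simp
  have "f (axis i t) \<le> 0"
  proof (cases "x $ i = 0")
    case True
    with assms(5) y show ?thesis by (simp add: y_def)
  next
    case False
    define s where "s = (t / x $ i + 1) / 2"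
    have "\<bar>t / x $ i\<bar> \<le> 1" using False assms(5) by (simp add: abs_divide)
    then have "- 1 \<le> t / x $ i" "t / x $ i \<le> 1" by linarith+
    then have "0 \<le> s" "s \<le> 1" by (simp_all add: s_def)
    with \<open>f (- y) \<le> 0\<close> y have "f ((1 - s) *\<^sub>R (- y) + s *\<^sub>R y) \<le> 0"
      by (intro comb)
    also have "(1 - s) *\<^sub>R (- y) + s *\<^sub>R y = axis i t"
      using False by (auto simp: vec_eq_iff y_def axis_def s_def field_simps)
    finally show ?thesis .
  qed
  moreover have "(\<chi> l. (axis i t :: real^'n) $ Transposition.transpose i j l) = axis j t"
    by (auto simp: vec_eq_iff axis_def Transposition.transpose_def)
  then have "f (axis j t) = f (axis i t)"
    using assms(2) permutes_swap_id[of i UNIV j] unfolding symmetric_fun_def by (metis UNIV_I)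
  ultimately show ?thesis by simp
qed

text \<open>
  The vectors with at most \<open>k\<close> nonzero entries form a closed set, as a finite union of coordinate
  subspaces.
\<close>

lemma compact_sparse_sublevel:
  fixes f :: "real^'n \<Rightarrow> real"
  assumes "continuous_on UNIV f" "bounded (sparse_sublevel f k)"
  shows "compact (sparse_sublevel f k)"
proof -
  have "closed (\<Union>T\<in>{T. card T \<le> k}. \<Inter>i\<in>-T. {x::real^'n. x $ i = 0})"
    by (intro closed_UN closed_INT ballI finite) (auto intro!: closed_Collect_eq continuous_intros)
  moreover have "(\<Union>T\<in>{T. card T \<le> k}. \<Inter>i\<in>-T. {x::real^'n. x $ i = 0}) = {x. card (supp x) \<le> k}"
  proof (intro subset_antisym subsetI)
    fix x :: "real^'n" assume "x \<in> (\<Union>T\<in>{T. card T \<le> k}. \<Inter>i\<in>-T. {x. x $ i = 0})"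
    then obtain T where "card T \<le> k" "supp x \<subseteq> T"
      by (auto simp: supp_def)
    then show "x \<in> {x. card (supp x) \<le> k}"
      using card_mono[of T "supp x"] by simp
  next
    fix x :: "real^'n" assume "x \<in> {x. card (supp x) \<le> k}"
    then show "x \<in> (\<Union>T\<in>{T. card T \<le> k}. \<Inter>i\<in>-T. {x. x $ i = 0})"
      by (intro UN_I[of "supp x"]) (auto simp: supp_def)
  qed
  moreover have "closed {x. f x \<le> 0}"
    using assms(1) by (intro closed_Collect_le) auto
  ultimately have "closed ({x. card (supp x) \<le> k} \<inter> {x. f x \<le> 0})"
    by (simp only: closed_Int)
  moreover have "{x. card (supp x) \<le> k} \<inter> {x. f x \<le> 0} = sparse_sublevel f k"
    by (auto simp: sparse_sublevel_def)
  ultimately show ?thesis using assms(2) by (simp add: compact_eq_bounded_closed)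
qed

text \<open>
  Unboundedness means arbitrarily large entries, so by \<open>axis_sublevel\<close> whole coordinate axes lie
  in the set, and these have the full space as convex hull.
\<close>

lemma convex_hull_unbounded_sparse_sublevel:
  fixes f :: "real^'n \<Rightarrow> real"
  assumes "convex_on UNIV f" "symmetric_fun f" "sign_invariant f" "1 \<le> k"
    and "\<not> bounded (sparse_sublevel f k)"
  shows "convex hull (sparse_sublevel f k) = UNIV"
proof -
  let ?n = "real CARD('n)"
  have axis: "axis j t \<in> sparse_sublevel f k" for j t
  proof -
    obtain x where x: "x \<in> sparse_sublevel f k" "?n * \<bar>t\<bar> < norm x"
      using assms(5) by (auto simp: bounded_iff not_le)
    have "\<exists>i. \<bar>t\<bar> \<le> \<bar>x $ i\<bar>"
    proof (rule ccontr)
      assume "\<nexists>i. \<bar>t\<bar> \<le> \<bar>x $ i\<bar>"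
      then have "(\<Sum>i\<in>UNIV. \<bar>x $ i\<bar>) \<le> (\<Sum>i\<in>(UNIV::'n set). \<bar>t\<bar>)"
        by (intro sum_mono) (metis le_cases)
      with x(2) norm_le_l1_cart[of x] show False by simp
    qed
    then obtain i where "\<bar>t\<bar> \<le> \<bar>x $ i\<bar>" by blast
    then have "f (axis j t) \<le> 0"
      using axis_sublevel[OF assms(1-3)] x(1) by (auto simp: sparse_sublevel_def)
    moreover have "supp (axis j t) \<subseteq> {j}" by (auto simp: supp_def axis_def)
    then have "card (supp (axis j t)) \<le> 1"
      using card_mono[of "{j}"] by fastforce
    ultimately show ?thesis using assms(4) by (simp add: sparse_sublevel_def)
  qed
  have "x \<in> convex hull (sparse_sublevel f k)" for x
  proof -
    have "(\<Sum>i\<in>UNIV. (1 / ?n) *\<^sub>R axis i (?n * x $ i)) \<in> convex hull (sparse_sublevel f k)"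
      by (intro convex_sum) (auto intro!: hull_inc axis)
    also have "(\<Sum>i\<in>UNIV. (1 / ?n) *\<^sub>R axis i (?n * x $ i)) = x"
      by (auto simp: vec_eq_iff axis_def if_distrib[of "\<lambda>z. _ * z"] cong: if_cong)
    finally show ?thesis .
  qed
  then show ?thesis by blast
qed

section \<open>Rank bounds for extreme points and optimal solutions\<close>

lemma strengthened_rank_hull:
  assumes "1 \<le> k"
  shows "convex hull (sparse_sublevel f k) = convex hull (sparse_sublevel f (strengthened_rank f k))"
proof -
  have "convex hull (domain_set f k) = convex hull (domain_set f (strengthened_rank f k))"
    unfolding strengthened_rank_def by (rule LeastI2[of _ k]) (use assms in auto)
  then show ?thesis
    by (simp add: convex_hull_domain_set inj_image_eq_iff[OF inj_Diag])
qed

lemma rank_extreme_point_le: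
  fixes f :: "real^'n \<Rightarrow> real"
  assumes "1 \<le> k" "symmetric_fun f" "sign_invariant f"
    and ext: "X extreme_point_of lsop_feasible f k A m bl bu"
  shows "rank X \<le> strengthened_rank f k + dim (span (A ` {1..m}))"
proof -
  define D where "D = sparse_sublevel f (strengthened_rank f k)"
  have feas: "lsop_feasible f k A m bl bu = Diag ` feasible_diagonals (convex hull D) A m bl bu"
    by (simp add: lsop_feasible_eq strengthened_rank_hull[OF assms(1)] D_def)
  obtain x where X: "X = Diag x"
    using ext feas by (auto simp: extreme_point_of_def)
  have "{X} face_of lsop_feasible f k A m bl bu"
    using ext by (simp add: face_of_singleton)
  then have ext_x: "x extreme_point_of feasible_diagonals (convex hull D) A m bl bu"
    using face_of_linear_image[OF linear_Diag inj_Diag, of "{x}"]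
    by (simp add: feas X face_of_singleton)
  have "dim (two_sided_directions (convex hull D) x) \<le> dim (span ((\<lambda>i. diag (A i)) ` {1..m}))"
    using ext_x unfolding feasible_diagonals_def
    by (intro dim_two_sided_directions_extreme_point
        [where P = "\<lambda>i r. bl i \<le> ereal r \<and> ereal r \<le> bu i"]) auto
  also have "\<dots> \<le> dim (span (A ` {1..m}))"
    using dim_diag_image_le[of "A ` {1..m}"] by (simp add: image_image)
  finally have "dim (two_sided_directions (convex hull D) x) \<le> dim (span (A ` {1..m}))" .
  moreover have "card (supp x) \<le> strengthened_rank f k + dim (two_sided_directions (convex hull D) x)"
  proof (rule card_supp_le_dim_two_sided_directions)
    show "y - ((axis p a - axis q b) \<bullet> y) *\<^sub>R (axis p a - axis q b) \<in> D"
      if "y \<in> D" "p \<noteq> q" "\<bar>a\<bar> = 1" "\<bar>b\<bar> = 1" for y p q a b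
      using sparse_sublevel_reflection[OF assms(2,3)] that unfolding D_def by blast
    show "card (supp y) \<le> strengthened_rank f k" if "y \<in> D" for y
      using that by (simp add: D_def sparse_sublevel_def)
    show "x \<in> convex hull D"
      using ext_x by (simp add: extreme_point_of_def feasible_diagonals_def)
  qed
  ultimately show ?thesis by (simp add: X rank_Diag)
qed

text \<open>The minimisers form a compact face, and its extreme points are extreme in the whole set.\<close>

lemma optimal_extreme_point_exists:
  fixes S :: "'a::euclidean_space set"
  assumes "compact S" "convex S" "S \<noteq> {}"
  obtains x where "x extreme_point_of S" "\<And>y. y \<in> S \<Longrightarrow> c \<bullet> x \<le> c \<bullet> y"
proof -
  obtain x0 where x0: "x0 \<in> S" "\<And>y. y \<in> S \<Longrightarrow> c \<bullet> x0 \<le> c \<bullet> y"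
    using continuous_attains_inf[OF assms(1,3), of "(\<bullet>) c"] continuous_on_inner[OF continuous_on_const continuous_on_id]
    by blast
  let ?T = "S \<inter> {x. c \<bullet> x = c \<bullet> x0}"
  have face: "?T face_of S"
    using assms(2) x0(2) by (rule face_of_Int_supporting_hyperplane_ge)
  have "compact ?T"
    using assms(1) by (simp add: compact_Int_closed closed_hyperplane)
  moreover have "?T \<noteq> {}" using x0(1) by blast
  ultimately obtain x where x: "x extreme_point_of ?T"
    using extreme_point_exists_convex face_of_imp_convex[OF face] by metis
  then have "x extreme_point_of S" "x \<in> ?T"
    using extreme_point_of_face[OF face] by auto
  with x0(2) that show ?thesis by auto
qed

text \<open>
  A nonzero diagonal matrix orthogonal to all constraint matrices would be the direction of a line
  through every feasible point.
\<close>

lemma no_line_imp_full_dim: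
  assumes "\<not> contains_line (Diag ` feasible_diagonals UNIV A m bl bu)"
    and x: "x \<in> feasible_diagonals UNIV A m bl bu"
  shows "CARD('n) \<le> dim (span (A ` {1..m} :: (real^'n^'n) set))"
proof (rule ccontr)
  assume "\<not> ?thesis"
  then have "dim (diag ` A ` {1..m}) < DIM(real^'n)"
    using dim_diag_image_le[of "A ` {1..m}"] by simp
  then obtain d where d: "d \<noteq> 0" "\<And>y. y \<in> span (diag ` A ` {1..m}) \<Longrightarrow> orthogonal d y"
    using orthogonal_to_subspace_exists by blast
  have "diag (A i) \<bullet> d = 0" if "i \<in> {1..m}" for i
    using d(2)[OF span_base, of "diag (A i)"] that by (simp add: orthogonal_def inner_commute)
  then have "x + t *\<^sub>R d \<in> feasible_diagonals UNIV A m bl bu" for t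
    using x by (simp add: feasible_diagonals_def inner_add_right)
  moreover have "Diag x + t *\<^sub>R Diag d = Diag (x + t *\<^sub>R d)" for t
    by (simp add: linear_add linear_scale linear_Diag)
  moreover have "Diag d \<noteq> 0"
    using d(1) inj_Diag linear_0[OF linear_Diag] by (metis injD)
  ultimately have "contains_line (Diag ` feasible_diagonals UNIV A m bl bu)"
    unfolding contains_line_def by (metis image_eqI)
  with assms(1) show False by blast
qed

theorem theorem8:
  fixes f :: "real^'n \<Rightarrow> real"
    and k m :: nat
    and A :: "nat \<Rightarrow> real^'n^'n"
    and bl bu :: "nat \<Rightarrow> ereal"
  assumes "1 \<le> k" and "k \<le> CARD('n)"
    and "continuous_on UNIV f" and "convex_on UNIV f" and "symmetric_fun f"
    and "\<forall>i\<in>{0..m}. A i \<in> sym_matrices"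
    and "\<forall>i\<in>{1..m}. bl i \<le> bu i"
    and "sign_invariant f"
    and "\<not> contains_line (lsop_feasible f k A m bl bu)"
  shows "(\<forall>X. X extreme_point_of lsop_feasible f k A m bl bu \<longrightarrow>
            rank X \<le> strengthened_rank f k + dim (span (A ` {1..m}))) \<and>
         (- \<infinity> < lsop_value f k A m bl bu \<and> lsop_value f k A m bl bu < \<infinity> \<longrightarrow>
            (\<exists>X. lsop_optimal f k A m bl bu X \<and>
                 rank X \<le> strengthened_rank f k + dim (span (A ` {1..m}))))"
proof (intro conjI allI impI)
  fix X assume "X extreme_point_of lsop_feasible f k A m bl bu"
  then show "rank X \<le> strengthened_rank f k + dim (span (A ` {1..m}))"
    using assms by (intro rank_extreme_point_le) auto
next
  let ?F = "lsop_feasible f k A m bl bu"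
  let ?P = "feasible_diagonals UNIV A m bl bu"
  assume val: "- \<infinity> < lsop_value f k A m bl bu \<and> lsop_value f k A m bl bu < \<infinity>"
  then obtain l where l: "lsop_value f k A m bl bu = ereal l"
    by (cases "lsop_value f k A m bl bu") auto
  have l_le: "l \<le> A 0 \<bullet> Y" if "Y \<in> ?F" for Y
    using INF_lower[OF that, of "\<lambda>Y. ereal (A 0 \<bullet> Y)"] l by (simp add: lsop_value_def)
  have ne: "?F \<noteq> {}"
    using l by (auto simp: lsop_value_def top_ereal_def)
  show "\<exists>X. lsop_optimal f k A m bl bu X \<and>
      rank X \<le> strengthened_rank f k + dim (span (A ` {1..m}))"
  proof (cases "bounded (sparse_sublevel f k)")
    case True
    let ?G = "feasible_diagonals (convex hull (sparse_sublevel f k)) A m bl bu"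
    have "compact (convex hull (sparse_sublevel f k))"
      using assms(3) True by (intro compact_convex_hull compact_sparse_sublevel)
    then have "compact ?G"
      by (subst feasible_diagonals_Int)
        (intro compact_Int_closed polyhedron_imp_closed polyhedron_feasible_diagonals)
    then have "compact ?F"
      unfolding lsop_feasible_eq
      by (intro compact_continuous_image linear_continuous_on)
        (simp_all add: linear_Diag flip: linear_conv_bounded_linear)
    moreover have "convex ?G"
      by (subst feasible_diagonals_Int)
        (intro convex_Int convex_convex_hull polyhedron_imp_convex polyhedron_feasible_diagonals)
    then have "convex ?F"
      unfolding lsop_feasible_eq by (rule convex_linear_image[OF linear_Diag])
    ultimately obtain X where "X extreme_point_of ?F" "\<And>Y. Y \<in> ?F \<Longrightarrow> A 0 \<bullet> X \<le> A 0 \<bullet> Y"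
      using ne optimal_extreme_point_exists by blast
    moreover from this have "rank X \<le> strengthened_rank f k + dim (span (A ` {1..m}))"
      using assms by (intro rank_extreme_point_le) auto
    ultimately show ?thesis
      by (auto simp: lsop_optimal_def extreme_point_of_def)
  next
    case False
    then have F: "?F = Diag ` ?P"
      using assms convex_hull_unbounded_sparse_sublevel[of f k] by (simp add: lsop_feasible_eq)
    have "?P \<noteq> {}" using ne F by auto
    moreover have "l \<le> diag (A 0) \<bullet> y" if "y \<in> ?P" for y
      using l_le[of "Diag y"] that by (simp add: F inner_Diag)
    ultimately obtain x where x: "x \<in> ?P" "\<And>y. y \<in> ?P \<Longrightarrow> diag (A 0) \<bullet> x \<le> diag (A 0) \<bullet> y"
      using linear_program_attains[OF polyhedron_feasible_diagonals] by blast
    have "rank (Diag x) \<le> CARD('n)"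
      using rank_bound[of "Diag x"] by simp
    also have "\<dots> \<le> dim (span (A ` {1..m}))"
      using no_line_imp_full_dim[OF _ x(1)] assms(9) F by simp
    finally have "rank (Diag x) \<le> strengthened_rank f k + dim (span (A ` {1..m}))" by simp
    moreover have "lsop_optimal f k A m bl bu (Diag x)"
      using x by (auto simp: lsop_optimal_def F inner_Diag)
    ultimately show ?thesis by blast
  qed
qed

end
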